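(* Let $G$ be a graph with vertices $v_1,\dots,v_n$ and let $H_1,\dots,H_n$ be graphs (where $H_i$ is allowed to have no vertices). Then \[ Z(G\prec H_1,\dots,H_n\succ)\le Z(G)+\sum_{i=1}^n Z(H_i), \] with the convention $Z(H_i)=0$ if $H_i$ has no vertices.
   Context: All graphs are finite, simple and undirected. Zero forcing: vertices are coloured black or white; if a black vertex $u$ has exactly one white neighbour $v$, then $v$ is recoloured black. A set $Z\subseteq V(G)$ is a zero forcing set if, starting with $Z$ black and all other vertices white, repeated application of this rule colours all vertices black; $Z(G)$ is the minimum size of a zero forcing set. The generalized corona $G\prec H_1,\dots,H_n\succ$ is obtained from the disjoint union of $G,H_1,\dots,H_n$ by joining every vertex of $H_i$ to the $i$-th vertex $v_i$ of $G$, for $i=1,\dots,n$ (if $H_i$ has no vertices, nothing is attached to $v_i$). *)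

theory Defs
  imports "Graph_Theory.Pair_Digraph"
begin

text \<open>
  Finite simple undirected graphs are the \<^locale>\<open>pair_graph\<close>s of the library: finite, loop-free
  and with a symmetric set of arcs. The graph without vertices is allowed.
\<close>

text \<open>
  A set \<open>B\<close> of vertices is the set of currently black vertices; one step applies the colour
  change rule to a single black vertex \<open>u\<close> whose only white neighbour is \<open>v\<close>.
\<close>

inductive forcing_step :: "'a pair_pre_digraph \<Rightarrow> 'a set \<Rightarrow> 'a set \<Rightarrow> bool"
  for G :: "'a pair_pre_digraph" where
  force: "u \<in> B \<Longrightarrow> {w \<in> pverts G - B. (u, w) \<in> parcs G} = {v} \<Longrightarrow> forcing_step G B (insert v B)"

definition zero_forcing_set :: "'a pair_pre_digraph \<Rightarrow> 'a set \<Rightarrow> bool" where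
  "zero_forcing_set G Z \<longleftrightarrow> Z \<subseteq> pverts G \<and> (forcing_step G)\<^sup>*\<^sup>* Z (pverts G)"

definition zero_forcing_number :: "'a pair_pre_digraph \<Rightarrow> nat" where
  "zero_forcing_number G = (LEAST k. \<exists>Z. zero_forcing_set G Z \<and> card Z = k)"

lemma zero_forcing_set_pverts: "zero_forcing_set G (pverts G)"
  by (simp add: zero_forcing_set_def)

lemma zero_forcing_number_no_vertices:
  assumes "pverts G = {}"
  shows "zero_forcing_number G = 0"
proof -
  have "\<exists>Z. zero_forcing_set G Z \<and> card Z = 0"
    using zero_forcing_set_pverts[of G] assms by (metis card.empty)
  then show ?thesis
    unfolding zero_forcing_number_def by (simp add: Least_eq_0)
qed

text \<open>
  In the generalized corona, \<open>v 1, \<dots>, v n\<close> is an enumeration of the vertices of \<open>G\<close>.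
  The disjoint union is realised by tagging: \<open>Inl u\<close> is the vertex \<open>u\<close> of \<open>G\<close>, and
  \<open>Inr (i, x)\<close> is the vertex \<open>x\<close> of \<open>H i\<close>. The last two sets of arcs are the two
  orientations of the edges joining \<open>v i\<close> to \<open>H i\<close>.
\<close>

definition generalized_corona ::
  "'a pair_pre_digraph \<Rightarrow> nat \<Rightarrow> (nat \<Rightarrow> 'a) \<Rightarrow> (nat \<Rightarrow> 'b pair_pre_digraph)
    \<Rightarrow> ('a + nat \<times> 'b) pair_pre_digraph" where
  "generalized_corona G n v H =
    \<lparr> pverts = Inl ` pverts G \<union> Inr ` (SIGMA i:{1..n}. pverts (H i)),
      parcs = {(Inl u, Inl w) | u w. (u, w) \<in> parcs G}
        \<union> {(Inr (i, x), Inr (i, y)) | i x y. i \<in> {1..n} \<and> (x, y) \<in> parcs (H i)}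
        \<union> {(Inl (v i), Inr (i, x)) | i x. i \<in> {1..n} \<and> x \<in> pverts (H i)}
        \<union> {(Inr (i, x), Inl (v i)) | i x. i \<in> {1..n} \<and> x \<in> pverts (H i)} \<rparr>"

lemma pair_graph_generalized_corona:
  assumes G: "pair_graph G"
    and v: "bij_betw v {1..n} (pverts G)"
    and H: "\<And>i. i \<in> {1..n} \<Longrightarrow> pair_graph (H i)"
  shows "pair_graph (generalized_corona G n v H)"
proof -
  let ?C = "generalized_corona G n v H"
  interpret G: pair_graph G by (fact G)
  have vG: "v i \<in> pverts G" if "i \<in> {1..n}" for i
    using v that by (auto simp: bij_betw_def)
  have HV: "x \<in> pverts (H i)" "y \<in> pverts (H i)" "x \<noteq> y" "(y, x) \<in> parcs (H i)"
    if "(x, y) \<in> parcs (H i)" "Suc 0 \<le> i" "i \<le> n" for i x y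
  proof -
    interpret Hi: pair_graph "H i" using H that(2,3) by simp
    show "x \<in> pverts (H i)" "y \<in> pverts (H i)" "x \<noteq> y" "(y, x) \<in> parcs (H i)"
      using Hi.in_arcsD1[OF that(1)] Hi.in_arcsD2[OF that(1)] Hi.pair_no_loops[OF that(1)]
        Hi.arcs_symmetric[OF that(1)] by simp_all
  qed
  have GV: "x \<in> pverts G" "y \<in> pverts G" "x \<noteq> y" "(y, x) \<in> parcs G"
    if "(x, y) \<in> parcs G" for x y
    using G.in_arcsD1[OF that] G.in_arcsD2[OF that] G.pair_no_loops[OF that]
      G.arcs_symmetric[OF that] by simp_all
  have finH: "finite (pverts (H i))" if "i \<in> {1..n}" for i
  proof -
    interpret Hi: pair_graph "H i" using H that .
    show ?thesis by (rule Hi.pair_finite_verts)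
  qed
  have fin: "finite (pverts ?C)"
    using G.pair_finite_verts finH by (auto simp: generalized_corona_def intro!: finite_imageI finite_SigmaI)
  have sub: "parcs ?C \<subseteq> pverts ?C \<times> pverts ?C"
    using GV(1,2) HV(1,2) vG by (fastforce simp: generalized_corona_def)
  have loop: "fst e \<noteq> snd e" if "e \<in> parcs ?C" for e
    using that by (auto simp: generalized_corona_def dest: GV(3) HV(3))
  have sym: "sym (parcs ?C)"
    by (rule symI) (auto simp: generalized_corona_def dest: GV(4) HV(4))
  show ?thesis
  proof unfold_locales
    show "finite (parcs ?C)" using fin sub by (meson finite_SigmaI finite_subset)
    show "symmetric (with_proj ?C)" using sym by (simp add: symmetric_def)
  qed (use fin sub loop in auto)
qed

end

theory Submission
  imports Defs
begin

text \<open>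
  Colour minimum zero forcing sets of \<open>G\<close> and of every \<open>H i\<close> black. As soon as \<open>v i\<close> is black, a
  vertex of \<open>H i\<close> has the same white neighbours in the corona as in \<open>H i\<close>, so \<open>H i\<close> turns black
  completely. From then on \<open>v i\<close> has the same white neighbours in the corona as in \<open>G\<close>, so the
  forcing process of \<open>G\<close> can be replayed, each newly black vertex being followed by the completion
  of its own \<open>H i\<close>.
\<close>

lemma zero_forcing_number_le: "zero_forcing_set G Z \<Longrightarrow> zero_forcing_number G \<le> card Z"
  unfolding zero_forcing_number_def by (rule Least_le) blast

lemma minimum_zero_forcing_set:
  obtains Z where "zero_forcing_set G Z" "card Z = zero_forcing_number G"
proof -
  have "\<exists>Z. zero_forcing_set G Z \<and> card Z = zero_forcing_number G"
    unfolding zero_forcing_number_def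
    by (rule LeastI_ex) (use zero_forcing_set_pverts in blast)
  then show ?thesis using that by blast
qed

lemma forcing_step_Un:
  assumes "forcing_step G A B"
  shows "(forcing_step G)\<^sup>*\<^sup>* (A \<union> C) (B \<union> C)"
  using assms
proof cases
  case (force u v)
  show ?thesis
  proof (cases "v \<in> C")
    case True
    then show ?thesis using force(1) by (simp add: insert_absorb)
  next
    case False
    then have "{w \<in> pverts G - (A \<union> C). (u, w) \<in> parcs G} = {v}"
      using force(3) by blast
    then have "forcing_step G (A \<union> C) (insert v (A \<union> C))"
      using force(2) by (intro forcing_step.force[of u]) auto
    then show ?thesis using force(1) by auto
  qed
qed

lemma forcing_steps_Un:
  assumes "(forcing_step G)\<^sup>*\<^sup>* A B"
  shows "(forcing_step G)\<^sup>*\<^sup>* (A \<union> C) (B \<union> C)"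
  using assms
proof (induction rule: rtranclp_induct)
  case (step X Y)
  from step.IH forcing_step_Un[OF step.hyps(2)] show ?case by (rule rtranclp_trans)
qed simp

text \<open>The only neighbour that a vertex of \<open>H i\<close> gains in the corona is
  \<open>v i\<close>, and \<open>Inl (v i)\<close> is kept black, so each force in
  \<open>H i\<close> is still valid.\<close>

lemma forcing_steps_corona_fibre:
  assumes i: "i \<in> {1..n}" and "(forcing_step (H i))\<^sup>*\<^sup>* A B"
  shows "(forcing_step (generalized_corona G n v H))\<^sup>*\<^sup>*
    (insert (Inl (v i)) ((\<lambda>x. Inr (i, x)) ` A)) (insert (Inl (v i)) ((\<lambda>x. Inr (i, x)) ` B))"
    (is "(forcing_step ?C)\<^sup>*\<^sup>* (?S A) (?S B)")
  using assms(2)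
proof (induction rule: rtranclp_induct)
  case (step X Y)
  from step.hyps(2) have "forcing_step ?C (?S X) (?S Y)"
  proof cases
    case (force u w)
    have "{y \<in> pverts ?C - ?S X. (Inr (i, u), y) \<in> parcs ?C}
        = (\<lambda>x. Inr (i, x)) ` {y \<in> pverts (H i) - X. (u, y) \<in> parcs (H i)}"
      using i by (auto simp: generalized_corona_def)
    also have "\<dots> = {Inr (i, w)}" using force(3) by simp
    finally have "forcing_step ?C (?S X) (insert (Inr (i, w)) (?S X))"
      using force(2) by (intro forcing_step.force[of "Inr (i, u)"]) auto
    then show ?thesis using force(1) by (simp add: insert_commute)
  qed
  with step.IH show ?case by (rule rtranclp.rtrancl_into_rtrancl)
qed simp

text \<open>The fibres are processed one at a time. The set \<open>R\<close> of further black
  vertices is arbitrary so that the induction can store finished fibres in it.\<close>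

lemma forcing_steps_corona_fibres:
  assumes "finite I" "I \<subseteq> {1..n}" "\<And>i. i \<in> I \<Longrightarrow> v i \<in> A"
    and "\<And>i. i \<in> I \<Longrightarrow> (forcing_step (H i))\<^sup>*\<^sup>* (Z i) (W i)"
  shows "(forcing_step (generalized_corona G n v H))\<^sup>*\<^sup>*
    (Inl ` A \<union> Inr ` Sigma I Z \<union> R) (Inl ` A \<union> Inr ` Sigma I W \<union> R)"
  using assms
proof (induction arbitrary: R rule: finite_induct)
  case (insert i I)
  let ?F = "\<lambda>A. (\<lambda>x. Inr (i, x)) ` A"
  have split: "Inr ` Sigma (insert i I) X = ?F (X i) \<union> Inr ` Sigma I X" for X
    by auto
  have absorb: "insert (Inl (v i)) (?F X) \<union> (Inl ` A \<union> S) = Inl ` A \<union> (?F X \<union> S)" for X S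
    using insert.prems(2)[of i] by auto
  have "(forcing_step (generalized_corona G n v H))\<^sup>*\<^sup>*
      (insert (Inl (v i)) (?F (Z i)) \<union> (Inl ` A \<union> (Inr ` Sigma I Z \<union> R)))
      (insert (Inl (v i)) (?F (W i)) \<union> (Inl ` A \<union> (Inr ` Sigma I Z \<union> R)))"
    using insert.prems by (intro forcing_steps_Un forcing_steps_corona_fibre) auto
  then have "(forcing_step (generalized_corona G n v H))\<^sup>*\<^sup>*
      (Inl ` A \<union> Inr ` Sigma (insert i I) Z \<union> R)
      (Inl ` A \<union> Inr ` Sigma I Z \<union> (?F (W i) \<union> R))"
    unfolding absorb split by (simp add: Un_ac)
  \<comment> \<open>The finished fibre over \<open>i\<close> now counts as part of \<open>R\<close>
    for the induction hypothesis.\<close>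
  also have "(forcing_step (generalized_corona G n v H))\<^sup>*\<^sup>*
      (Inl ` A \<union> Inr ` Sigma I Z \<union> (?F (W i) \<union> R))
      (Inl ` A \<union> Inr ` Sigma I W \<union> (?F (W i) \<union> R))"
    using insert.prems by (intro insert.IH) auto
  finally show ?case unfolding split by (simp add: Un_ac)
qed simp

text \<open>The state \<open>?S X\<close> is the invariant of the replay: fibres over black vertices
  of \<open>G\<close> are complete, all others still hold their initial set
  \<open>Z i\<close>.\<close>

lemma forcing_steps_corona_base:
  assumes Z: "\<And>i. i \<in> {1..n} \<Longrightarrow> zero_forcing_set (H i) (Z i)"
    and "(forcing_step G)\<^sup>*\<^sup>* A B"
  shows "(forcing_step (generalized_corona G n v H))\<^sup>*\<^sup>*
    (Inl ` A \<union> Inr ` Sigma {1..n} Z)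
    (Inl ` B \<union> Inr ` (SIGMA i:{1..n}. if v i \<in> B then pverts (H i) else Z i))"
    (is "(forcing_step ?C)\<^sup>*\<^sup>* _ (?S B)")
proof -
  \<comment> \<open>Here \<open>X\<close> is black in \<open>G\<close>, but only the fibres over
    \<open>Y\<close> are complete. Over \<open>Y\<close> nothing remains to be done, over
    \<open>X - Y\<close> the forcing process of \<open>Z i\<close> is run, and the fibres over white
    vertices are set aside in \<open>?R\<close>.\<close>
  have fill: "(forcing_step ?C)\<^sup>*\<^sup>*
      (Inl ` X \<union> Inr ` (SIGMA i:{1..n}. if v i \<in> Y then pverts (H i) else Z i)) (?S X)"
    if "Y \<subseteq> X" for X Y
  proof -
    let ?I = "{i \<in> {1..n}. v i \<in> X}"
    let ?R = "Inr ` (SIGMA i:{i \<in> {1..n}. v i \<notin> X}. Z i)"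
    have "(forcing_step ?C)\<^sup>*\<^sup>*
        (Inl ` X \<union> Inr ` (SIGMA i:?I. if v i \<in> Y then pverts (H i) else Z i) \<union> ?R)
        (Inl ` X \<union> Inr ` (SIGMA i:?I. pverts (H i)) \<union> ?R)"
      using Z by (intro forcing_steps_corona_fibres) (auto simp: zero_forcing_set_def)
    moreover have "Inl ` X \<union> Inr ` (SIGMA i:?I. if v i \<in> Y then pverts (H i) else Z i) \<union> ?R
        = Inl ` X \<union> Inr ` (SIGMA i:{1..n}. if v i \<in> Y then pverts (H i) else Z i)"
      using that by (auto simp: image_iff split: if_splits)
    moreover have "Inl ` X \<union> Inr ` (SIGMA i:?I. pverts (H i)) \<union> ?R = ?S X"
      by (auto split: if_splits)
    ultimately show ?thesis by simp
  qed
  show ?thesis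
    using assms(2)
  proof (induction rule: rtranclp_induct)
    case base
    \<comment> \<open>At the start no fibre has been completed, hence the empty set.\<close>
    show ?case using fill[of "{}" A] by simp
  next
    case (step X Y)
    from step.hyps(2) have "(forcing_step ?C)\<^sup>*\<^sup>* (?S X) (?S Y)"
    proof cases
      case (force u w)
      \<comment> \<open>Since \<open>u\<close> is in \<open>X\<close>, any fibre attached to
        \<open>u\<close> is entirely black, so white neighbours can only come from
        \<open>G\<close>.\<close>
      have "{y \<in> pverts ?C - ?S X. (Inl u, y) \<in> parcs ?C}
          = Inl ` {y \<in> pverts G - X. (u, y) \<in> parcs G}"
        using force(2) by (auto simp: generalized_corona_def)
      also have "\<dots> = {Inl w}" using force(3) by simp
      finally have "forcing_step ?C (?S X) (insert (Inl w) (?S X))"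
        using force(2) by (intro forcing_step.force[of "Inl u"]) auto
      also have "insert (Inl w) (?S X)
          = Inl ` Y \<union> Inr ` (SIGMA i:{1..n}. if v i \<in> X then pverts (H i) else Z i)"
        using force(1) by auto
      finally show ?thesis
        using fill[of X Y] force(1) by (auto intro: converse_rtranclp_into_rtranclp)
    qed
    with step.IH show ?case by (rule rtranclp_trans)
  qed
qed

lemma zero_forcing_set_corona:
  assumes "zero_forcing_set G A" "v ` {1..n} \<subseteq> pverts G"
    and "\<And>i. i \<in> {1..n} \<Longrightarrow> zero_forcing_set (H i) (Z i)"
  shows "zero_forcing_set (generalized_corona G n v H) (Inl ` A \<union> Inr ` Sigma {1..n} Z)"
proof -
  let ?C = "generalized_corona G n v H"
  have "Inl ` A \<union> Inr ` Sigma {1..n} Z \<subseteq> pverts ?C"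
    using assms(1,3) by (fastforce simp: generalized_corona_def zero_forcing_set_def)
  \<comment> \<open>Once all of \<open>G\<close> is black, the invariant state is the full vertex
    set of the corona.\<close>
  moreover have "Inl ` pverts G
      \<union> Inr ` (SIGMA i:{1..n}. if v i \<in> pverts G then pverts (H i) else Z i) = pverts ?C"
    using assms(2) by (auto simp: generalized_corona_def)
  ultimately show ?thesis
    using forcing_steps_corona_base[of n H Z G A "pverts G" v] assms(1,3)
    by (simp add: zero_forcing_set_def)
qed

theorem theorem4p20:
  fixes G :: "'a pair_pre_digraph" and H :: "nat \<Rightarrow> 'b pair_pre_digraph"
    and n :: nat and v :: "nat \<Rightarrow> 'a"
  assumes "pair_graph G"
    and "bij_betw v {1..n} (pverts G)"
    and "\<And>i. i \<in> {1..n} \<Longrightarrow> pair_graph (H i)"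
  shows "zero_forcing_number (generalized_corona G n v H)
    \<le> zero_forcing_number G + (\<Sum>i=1..n. zero_forcing_number (H i))"
proof -
  obtain A where A: "zero_forcing_set G A" "card A = zero_forcing_number G"
    by (rule minimum_zero_forcing_set)
  have "\<exists>Z. \<forall>i. zero_forcing_set (H i) (Z i) \<and> card (Z i) = zero_forcing_number (H i)"
    by (intro choice allI) (metis minimum_zero_forcing_set)
  then obtain Z where Z: "\<And>i. zero_forcing_set (H i) (Z i)"
      "\<And>i. card (Z i) = zero_forcing_number (H i)"
    by blast
  have fin: "finite (Z i)" if "i \<in> {1..n}" for i
  proof -
    interpret Hi: pair_graph "H i" using assms(3) that .
    show ?thesis
      using Z(1)[of i] Hi.pair_finite_verts by (auto simp: zero_forcing_set_def intro: finite_subset)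
  qed
  have "zero_forcing_number (generalized_corona G n v H)
      \<le> card (Inl ` A \<union> Inr ` Sigma {1..n} Z)"
    using A(1) Z(1) assms(2)
    by (intro zero_forcing_number_le zero_forcing_set_corona) (auto simp: bij_betw_def)
  \<comment> \<open>Tagging is injective and so preserves cardinality; finiteness of each
    \<open>Z i\<close> turns the size of the \<open>Sigma\<close> set into the sum.\<close>
  also have "\<dots> \<le> card A + (\<Sum>i=1..n. card (Z i))"
    by (rule order_trans[OF card_Un_le]) (use fin in \<open>simp add: card_image card_SigmaI\<close>)
  finally show ?thesis by (simp add: A(2) Z(2))
qed

end
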